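(* Let $G$ be a nontrivial ordered additive abelian group. For all integers $h\ge 3$ and $k\ge 3$, \[ hk-h+1 = \min \mathcal{R}_G(h,k) \qquad\text{but}\qquad hk-h+2 \notin \mathcal{R}_G(h,k). \] In particular, $\mathcal{R}_G(h,k)$ is not an interval of consecutive integers.
   Context: An additive abelian group $G$ is ordered with respect to a total order $<$ if $x<y$ implies $x+z<y+z$ for all $x,y,z\in G$. For a nonempty subset $A$ of $G$ and a positive integer $h$, $hA=\{a_1+\cdots+a_h : a_i\in A\}$ (summands not necessarily distinct). $\mathcal{R}_G(h,k)=\{|hA| : A\subseteq G,\ |A|=k\}$. *)

theory Defs
  imports Main
begin

definition hfold_sumset :: "nat \<Rightarrow> 'a::comm_monoid_add set \<Rightarrow> 'a set" where
  "hfold_sumset h A = {(\<Sum>i<h. a i) | a. \<forall>i<h. a i \<in> A}"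

text \<open>Finiteness of \<open>A\<close> is explicit because \<open>card\<close> is \<open>0\<close> on infinite sets.\<close>

definition sumset_sizes :: "'a::comm_monoid_add set \<Rightarrow> nat \<Rightarrow> nat \<Rightarrow> nat set" where
  "sumset_sizes G h k = {card (hfold_sumset h A) | A. A \<subseteq> G \<and> finite A \<and> card A = k}"

text \<open>Intervals of consecutive integers, in the order-convex sense: this covers bounded
  intervals \<open>{m..n}\<close> as well as rays \<open>{m..}\<close>.\<close>

definition nat_interval :: "nat set \<Rightarrow> bool" where
  "nat_interval S \<longleftrightarrow> (\<forall>x\<in>S. \<forall>y\<in>S. {x..y} \<subseteq> S)"

end

theory Submission
  imports Defs
begin

text \<open>
  Adjoining to \<open>A\<close> a new maximum \<open>x\<close> (or, dually, a new minimum) adds at least \<open>h\<close> elements to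
  \<open>hA\<close>: with \<open>m\<close> the old maximum, the sums \<open>s x + (h - s) m\<close> for \<open>1 \<le> s \<le> h\<close> all exceed \<open>h m\<close>.
  Hence \<open>|hA| \<ge> h (k - 1) + 1\<close>, with equality for arithmetic progressions. If \<open>A\<close> is not a
  progression, it contains three consecutive elements \<open>a < b < c\<close> with \<open>b - a \<noteq> c - b\<close>. For those,
  the \<open>3h\<close> sums with \<open>i \<le> 2\<close> copies of \<open>b\<close> and \<open>j \<le> h - i\<close> copies of \<open>c\<close> are distinct, and
  adjoining the other elements one at a time gives \<open>|hA| \<ge> hk\<close>. For \<open>h \<ge> 3\<close> this exceeds
  \<open>hk - h + 2\<close>.
\<close>

section \<open>Multiples of an element in an ordered group\<close>

text \<open>Written as a constant sum, so that \<open>nmult n x\<close> is literally the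
  \<open>n\<close>-fold sum of a constant choice function, as in
  \<open>hfold_sumset\<close>.\<close>

definition nmult :: "nat \<Rightarrow> 'a::comm_monoid_add \<Rightarrow> 'a" where
  "nmult n x = (\<Sum>i<n. x)"

lemma nmult_0 [simp]: "nmult 0 x = 0"
  by (simp add: nmult_def)

lemma nmult_Suc [simp]: "nmult (Suc n) x = nmult n x + x"
  by (simp add: nmult_def)

lemma nmult_add: "nmult (m + n) x = nmult m x + nmult n x"
  by (induction n) (simp_all add: add.assoc)

lemma nmult_minus: "nmult n (x - y) = nmult n x - nmult n (y::'a::ab_group_add)"
  by (simp add: nmult_def sum_subtractf)

lemma nmult_less_mono:
  fixes x :: "'a::linordered_ab_group_add"
  assumes "0 < x" "m < n"
  shows "nmult m x < nmult n x"
  using assms(2)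
proof (rule less_Suc_induct)
  show "nmult i x < nmult (Suc i) x" for i
    using assms(1) by simp
qed (rule less_trans)

lemma nmult_le_mono:
  fixes x :: "'a::linordered_ab_group_add"
  assumes "0 < x" "m \<le> n"
  shows "nmult m x \<le> nmult n x"
  using nmult_less_mono[OF assms(1), of m n] assms(2) by (cases "m = n") auto

text \<open>Ordered groups are torsion-free; the distinctness of sums in the later counts comes from
  here.\<close>

lemma nmult_inject:
  fixes x :: "'a::linordered_ab_group_add"
  assumes "0 < x"
  shows "nmult m x = nmult n x \<longleftrightarrow> m = n"
  using nmult_less_mono[OF assms] by (metis less_irrefl linorder_neqE_nat)

section \<open>Basic properties of h-fold sumsets\<close>

lemma mem_sumset_sizesI:
  "finite A \<Longrightarrow> card A = k \<Longrightarrow> A \<subseteq> G \<Longrightarrow> card (hfold_sumset h A) \<in> sumset_sizes G h k"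
  unfolding sumset_sizes_def by blast

lemma hfold_sumset_0 [simp]: "hfold_sumset 0 A = {0}"
  by (auto simp: hfold_sumset_def)

lemma hfold_sumset_Suc: "hfold_sumset (Suc h) A = (\<lambda>(x, y). x + y) ` (hfold_sumset h A \<times> A)"
proof (intro equalityI subsetI)
  fix z assume "z \<in> hfold_sumset (Suc h) A"
  then obtain f where f: "\<forall>i<Suc h. f i \<in> A" "z = (\<Sum>i<Suc h. f i)"
    by (auto simp: hfold_sumset_def)
  then have "(\<Sum>i<h. f i) \<in> hfold_sumset h A"
    by (force simp: hfold_sumset_def)
  then show "z \<in> (\<lambda>(x, y). x + y) ` (hfold_sumset h A \<times> A)"
    using f by force
next
  fix z assume "z \<in> (\<lambda>(x, y). x + y) ` (hfold_sumset h A \<times> A)"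
  then obtain f y where f: "\<forall>i<h. f i \<in> A" "y \<in> A" "z = (\<Sum>i<h. f i) + y"
    by (auto simp: hfold_sumset_def)
  then have "z = (\<Sum>i<Suc h. (f(h := y)) i)" "\<forall>i<Suc h. (f(h := y)) i \<in> A"
    by auto
  then show "z \<in> hfold_sumset (Suc h) A"
    unfolding hfold_sumset_def by blast
qed

lemma add_mem_hfold_sumset_Suc:
  "x \<in> hfold_sumset h A \<Longrightarrow> y \<in> A \<Longrightarrow> x + y \<in> hfold_sumset (Suc h) A"
  unfolding hfold_sumset_Suc by force

lemma finite_hfold_sumset: "finite A \<Longrightarrow> finite (hfold_sumset h A)"
  by (induction h) (auto simp: hfold_sumset_Suc)

lemma hfold_sumset_mono: "A \<subseteq> B \<Longrightarrow> hfold_sumset h A \<subseteq> hfold_sumset h B"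
  by (auto simp: hfold_sumset_def)

lemma nmult_mem_hfold_sumset: "x \<in> A \<Longrightarrow> nmult n x \<in> hfold_sumset n A"
  by (auto simp: hfold_sumset_def nmult_def)

text \<open>Lets a sum be assembled from blocks of equal summands.\<close>

lemma add_mem_hfold_sumset:
  assumes "x \<in> hfold_sumset m A" "y \<in> hfold_sumset n A"
  shows "x + y \<in> hfold_sumset (m + n) A"
  using assms(2)
proof (induction n arbitrary: y)
  case (Suc n)
  then obtain u v where "u \<in> hfold_sumset n A" "v \<in> A" "y = u + v"
    by (auto simp: hfold_sumset_Suc)
  with add_mem_hfold_sumset_Suc[OF Suc.IH] show ?case
    by (simp add: add.assoc)
qed (use assms(1) in auto)

lemma hfold_sumset_le:
  fixes m :: "'a::linordered_ab_group_add"
  assumes "\<And>a. a \<in> A \<Longrightarrow> a \<le> m" "x \<in> hfold_sumset h A"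
  shows "x \<le> nmult h m"
  using assms by (auto simp: hfold_sumset_def nmult_def intro!: sum_mono)

text \<open>Negation reverses the order, so this transfers results about a new maximum to a new
  minimum.\<close>

lemma hfold_sumset_uminus:
  fixes A :: "'a::ab_group_add set"
  shows "hfold_sumset h (uminus ` A) = uminus ` hfold_sumset h A"
proof (induction h)
  case (Suc h)
  show ?case
    unfolding hfold_sumset_Suc Suc by (force simp: image_iff)
qed auto

lemma card_uminus_image: "card (uminus ` A) = card (A :: 'a::group_add set)"
  by (rule card_image) simp

section \<open>Adjoining an extreme element, and the lower bound\<close>

lemma card_hfold_sumset_insert_max:
  fixes x :: "'a::linordered_ab_group_add"
  assumes "finite A" "A \<noteq> {}" and less: "\<And>a. a \<in> A \<Longrightarrow> a < x"
  shows "card (hfold_sumset h A) + h \<le> card (hfold_sumset h (insert x A))"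
proof -
  define m where "m = Max A"
  have m: "m \<in> A" "m < x"
    using assms by (auto simp: m_def)
  \<comment> \<open>\<open>f s\<close> is the sum of \<open>s\<close> copies of \<open>x\<close> and
    \<open>h - s\<close> copies of \<open>m\<close>. Writing it relative to \<open>nmult h m\<close>
    reduces both injectivity and \<open>f s > nmult h m\<close> to multiples of the positive element
    \<open>x - m\<close>.\<close>
  define f where "f s = nmult h m + nmult s (x - m)" for s
  have pos: "0 < x - m" using m by simp
  have mem: "f s \<in> hfold_sumset h (insert x A)" if "s \<le> h" for s
  proof -
    have "nmult h m = nmult s m + nmult (h - s) m"
      using that nmult_add[of s "h - s" m] by simp
    then have "f s = nmult s x + nmult (h - s) m"
      by (simp add: f_def nmult_minus)
    then show ?thesis
      using add_mem_hfold_sumset[of "nmult s x" s "insert x A" "nmult (h - s) m" "h - s"]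
        nmult_mem_hfold_sumset[of _ "insert x A"] m that by simp
  qed
  have "inj_on f {1..h}"
    using nmult_inject[OF pos] by (auto simp: inj_on_def f_def)
  then have card_f: "card (f ` {1..h}) = h"
    by (simp add: card_image)
  have "f s \<notin> hfold_sumset h A" if "1 \<le> s" for s
  proof
    assume "f s \<in> hfold_sumset h A"
    then have "f s \<le> nmult h m"
      by (rule hfold_sumset_le[rotated]) (simp add: m_def assms)
    moreover have "0 < nmult s (x - m)"
      using nmult_less_mono[OF pos, of 0 s] that by simp
    ultimately show False
      by (simp add: f_def)
  qed
  then have "hfold_sumset h A \<inter> f ` {1..h} = {}"
    by auto
  then have "card (hfold_sumset h A) + h = card (hfold_sumset h A \<union> f ` {1..h})"
    using card_f assms(1) by (simp add: card_Un_disjoint finite_hfold_sumset)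
  also have "\<dots> \<le> card (hfold_sumset h (insert x A))"
    using mem hfold_sumset_mono[of A "insert x A" h] assms(1)
    by (intro card_mono) (auto simp: finite_hfold_sumset)
  finally show ?thesis .
qed

lemma card_hfold_sumset_insert_min:
  fixes x :: "'a::linordered_ab_group_add"
  assumes "finite A" "A \<noteq> {}" "\<And>a. a \<in> A \<Longrightarrow> x < a"
  shows "card (hfold_sumset h A) + h \<le> card (hfold_sumset h (insert x A))"
proof -
  have "card (hfold_sumset h (uminus ` A)) + h \<le> card (hfold_sumset h (uminus ` insert x A))"
    unfolding image_insert using assms by (intro card_hfold_sumset_insert_max) auto
  then show ?thesis
    by (simp only: hfold_sumset_uminus card_uminus_image)
qed

text \<open>Adjoin the elements in increasing order: each one after the first contributes at least
  \<open>h\<close> new sums.\<close>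

lemma card_hfold_sumset_ge:
  fixes A :: "'a::linordered_ab_group_add set"
  assumes "finite A" "A \<noteq> {}"
  shows "h * (card A - 1) + 1 \<le> card (hfold_sumset h A)"
  using assms
proof (induction rule: finite_linorder_max_induct)
  case (insert x A)
  show ?case
  proof (cases "A = {}")
    case True
    \<comment> \<open>For a singleton the bound is 1, so it is enough that the sumset is
      nonempty.\<close>
    have "nmult h x \<in> hfold_sumset h {x}"
      by (simp add: nmult_mem_hfold_sumset)
    then have "card (hfold_sumset h {x}) \<noteq> 0"
      by (auto simp: finite_hfold_sumset)
    then show ?thesis using True by simp
  next
    case False
    then have "card A \<noteq> 0" "x \<notin> A" using insert.hyps by auto
    moreover have "h * (card A - 1) + 1 + h \<le> card (hfold_sumset h (insert x A))"
      using card_hfold_sumset_insert_max[of A x h] insert False by force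
    ultimately show ?thesis
      using insert.hyps by (cases "card A") auto
  qed
qed simp

section \<open>Arithmetic progressions\<close>

definition progression :: "'a::comm_monoid_add \<Rightarrow> 'a \<Rightarrow> nat \<Rightarrow> 'a set" where
  "progression a d n = (\<lambda>i. a + nmult i d) ` {..<n}"

lemma finite_progression [simp]: "finite (progression a d n)"
  by (simp add: progression_def)

lemma mem_progression_iff: "x \<in> progression a d n \<longleftrightarrow> (\<exists>i<n. x = a + nmult i d)"
  by (auto simp: progression_def)

lemma first_mem_progression: "0 < n \<Longrightarrow> a \<in> progression a d n"
  by (auto simp: mem_progression_iff intro: exI[of _ 0])

lemma progression_0 [simp]: "progression a d 0 = {}"
  by (simp add: progression_def)

lemma progression_Suc: "progression a d (Suc n) = insert (a + nmult n d) (progression a d n)"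
  by (simp add: progression_def lessThan_Suc)

lemma progression_insert_first:
  fixes a :: "'a::ab_group_add"
  shows "insert (a - d) (progression a d n) = progression (a - d) d (Suc n)"
  by (simp add: progression_def lessThan_Suc_eq_insert_0 image_image algebra_simps)

lemma card_progression:
  fixes d :: "'a::linordered_ab_group_add"
  assumes "0 < d"
  shows "card (progression a d n) = n"
  using nmult_inject[OF assms] by (simp add: progression_def card_image inj_on_def)

text \<open>With \<open>Suc n\<close> terms each index is at most \<open>n\<close>, so
  \<open>h\<close> summands contribute at most \<open>h * n\<close> copies of
  \<open>d\<close>.\<close>

lemma hfold_sumset_progression_subset:
  "hfold_sumset h (progression a d (Suc n)) \<subseteq> (\<lambda>j. nmult h a + nmult j d) ` {..h * n}"
proof (induction h)
  case (Suc h)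
  show ?case
  proof
    fix z assume "z \<in> hfold_sumset (Suc h) (progression a d (Suc n))"
    then obtain y x where y: "y \<in> hfold_sumset h (progression a d (Suc n))"
      and x: "x \<in> progression a d (Suc n)" "z = y + x"
      by (auto simp: hfold_sumset_Suc)
    then obtain i where i: "i \<le> n" "z = y + (a + nmult i d)"
      by (auto simp: mem_progression_iff less_Suc_eq_le)
    from y Suc obtain j where "j \<le> h * n" "y = nmult h a + nmult j d"
      by auto
    with i have "j \<le> h * n" "i \<le> n" "z = (nmult h a + nmult j d) + (a + nmult i d)"
      by simp_all
    then have "j + i \<le> Suc h * n" "z = nmult (Suc h) a + nmult (j + i) d"
      by (simp_all add: nmult_add ac_simps add_mono)
    then show "z \<in> (\<lambda>j. nmult (Suc h) a + nmult j d) ` {..Suc h * n}"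
      by blast
  qed
qed simp

lemma card_hfold_sumset_progression_le:
  "card (hfold_sumset h (progression a d (Suc n))) \<le> h * n + 1"
proof -
  have "card (hfold_sumset h (progression a d (Suc n))) \<le> card ((\<lambda>j. nmult h a + nmult j d) ` {..h * n})"
    by (intro card_mono hfold_sumset_progression_subset) auto
  also have "\<dots> \<le> h * n + 1"
    using card_image_le[of "{..h * n}"] by simp
  finally show ?thesis .
qed

section \<open>Three elements with unequal gaps\<close>

text \<open>Cancelling \<open>i\<close> copies of \<open>u\<close> leaves a relation with
  \<open>p = i' - i \<le> 2\<close> copies of \<open>u\<close>. If \<open>p > 0\<close>, it becomes
  \<open>p u = (q + 1) v\<close>. Then \<open>p = 1\<close> contradicts \<open>u < v\<close>, the
  case \<open>p = 2\<close>, \<open>q = 0\<close> contradicts \<open>u + u \<noteq> v\<close>, and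
  \<open>p = 2\<close>, \<open>q \<ge> 1\<close> contradicts \<open>u + u < v + v\<close>.\<close>

lemma two_nmult_eq_imp:
  fixes u v :: "'a::linordered_ab_group_add"
  assumes uv: "0 < u" "u < v" "u + u \<noteq> v"
    and eq: "nmult i u + nmult j v = nmult i' u + nmult j' v" and "i \<le> i'" "i' \<le> 2"
  shows "i = i' \<and> j = j'"
proof -
  have v: "0 < v" using uv by order
  define p where "p = i' - i"
  have i': "i' = i + p" "p \<le> 2" using assms by (auto simp: p_def)
  have eq': "nmult j v = nmult p u + nmult j' v"
    using eq unfolding i' by (simp add: nmult_add add.assoc)
  show ?thesis
  proof (cases "p = 0")
    case True
    then show ?thesis using eq' i' nmult_inject[OF v] by simp
  next
    case False
    have "0 < nmult p u"
      using nmult_less_mono[OF uv(1), of 0 p] False by simp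
    then have "nmult j' v < nmult j v"
      unfolding eq' by simp
    then have "j' < j"
      using nmult_le_mono[OF v, of j j'] by (meson leD not_le_imp_less)
    then obtain q where q: "j = j' + Suc q"
      using less_imp_Suc_add by auto
    then have pq: "nmult p u = nmult q v + v"
      using eq' by (simp add: nmult_add add.commute)
    have ge0: "0 \<le> nmult q v"
      using nmult_le_mono[OF v, of 0 q] by simp
    consider "p = 1" | "p = 2" "q = 0" | "p = 2" "1 \<le> q"
      using False i' by linarith
    then show ?thesis
    proof cases
      case 1
      then have "v \<le> u" using pq ge0 by simp
      then show ?thesis using uv by simp
    next
      case 2
      then show ?thesis using pq uv(3) by (simp add: numeral_2_eq_2)
    next
      case 3
      then have "v \<le> nmult q v" using nmult_le_mono[OF v, of 1 q] by simp
      then have "v + v \<le> u + u" using pq 3 by (simp add: numeral_2_eq_2)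
      moreover have "u + u < v + v" using uv by (simp add: add_strict_mono)
      ultimately show ?thesis by simp
    qed
  qed
qed

lemma card_hfold_sumset_triple:
  fixes a b c :: "'a::linordered_ab_group_add"
  assumes "a < b" "b < c" "b - a \<noteq> c - b" "2 \<le> h"
  shows "h * 3 \<le> card (hfold_sumset h {a, b, c})"
proof -
  \<comment> \<open>Both differences are taken from \<open>a\<close>, so unequal gaps become
    \<open>u + u \<noteq> v\<close>.\<close>
  define u v where "u = b - a" and "v = c - a"
  have uv: "0 < u" "u < v" "u + u \<noteq> v"
    using assms by (auto simp: u_def v_def algebra_simps)
  \<comment> \<open>A pair \<open>(i, j)\<close> stands for \<open>i\<close> copies of
    \<open>b\<close>, \<open>j\<close> of \<open>c\<close> and \<open>h - i - j\<close> of
    \<open>a\<close>. The rows have sizes \<open>h + 1\<close>, \<open>h\<close> and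
    \<open>h - 1\<close>, in total \<open>3h\<close>; \<open>2 \<le> h\<close> keeps
    \<open>h - i\<close> from being truncated.\<close>
  define S where "S = Sigma {..2::nat} (\<lambda>i. {..h - i})"
  define f where "f = (\<lambda>(i, j). nmult h a + (nmult i u + nmult j v))"
  have "card S = (\<Sum>i\<le>2. card {..h - i})"
    unfolding S_def by (rule card_SigmaI) auto
  also have "\<dots> = h * 3"
    using assms(4) by (simp add: numeral_2_eq_2)
  finally have card_S: "card S = h * 3" .
  have "inj_on f S"
  proof (rule inj_onI)
    fix x y assume xy: "x \<in> S" "y \<in> S" "f x = f y"
    obtain i j i' j' where ij: "x = (i, j)" "y = (i', j')" by (cases x, cases y)
    have le: "i \<le> 2" "i' \<le> 2" and eq: "nmult i u + nmult j v = nmult i' u + nmult j' v"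
      using xy by (auto simp: ij S_def f_def)
    show "x = y"
      using two_nmult_eq_imp[OF uv eq] two_nmult_eq_imp[OF uv eq[symmetric]] le
      by (cases "i \<le> i'") (auto simp: ij)
  qed
  moreover have "f ` S \<subseteq> hfold_sumset h {a, b, c}"
  proof
    fix z assume "z \<in> f ` S"
    then obtain i j where ij: "i \<le> 2" "j \<le> h - i" and z: "z = f (i, j)"
      by (auto simp: S_def)
    have h: "i + (j + (h - i - j)) = h" using ij assms(4) by simp
    then have "nmult h a = nmult i a + (nmult j a + nmult (h - i - j) a)"
      by (metis nmult_add)
    then have "z = nmult i b + (nmult j c + nmult (h - i - j) a)"
      by (simp add: z f_def u_def v_def nmult_minus)
    moreover have "\<dots> \<in> hfold_sumset (i + (j + (h - i - j))) {a, b, c}"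
      by (intro add_mem_hfold_sumset nmult_mem_hfold_sumset) auto
    ultimately show "z \<in> hfold_sumset h {a, b, c}"
      by (simp only: h)
  qed
  ultimately show ?thesis
    using card_S card_inj_on_le[of f S] by (simp add: finite_hfold_sumset)
qed

section \<open>Sets that are not progressions\<close>

text \<open>The elements \<open>x\<close>, \<open>a\<close>, \<open>a + d\<close> have unequal gaps
  and already give \<open>3h\<close> sums; each further term of the progression is a new maximum and
  adds at least \<open>h\<close>.\<close>

lemma card_hfold_sumset_insert_progression:
  fixes a :: "'a::linordered_ab_group_add"
  assumes "0 < d" "x < a" "x \<noteq> a - d" "2 \<le> h" "2 \<le> n"
  shows "h * Suc n \<le> card (hfold_sumset h (insert x (progression a d n)))"
  using assms(5)
proof (induction n rule: dec_induct)
  case base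
  have "insert x (progression a d 2) = {x, a, a + d}"
    by (auto simp: numeral_2_eq_2 progression_Suc)
  then show ?case
    using card_hfold_sumset_triple[of x a "a + d" h] assms by (simp add: algebra_simps)
next
  case (step n)
  have "0 \<le> nmult n d"
    using nmult_le_mono[OF assms(1), of 0 n] by simp
  then have "x < a + nmult n d"
    using add_less_le_mono[OF assms(2), of 0 "nmult n d"] by simp
  then have "card (hfold_sumset h (insert x (progression a d n))) + h
      \<le> card (hfold_sumset h (insert (a + nmult n d) (insert x (progression a d n))))"
    using nmult_less_mono[OF assms(1)]
    by (intro card_hfold_sumset_insert_max) (auto simp: mem_progression_iff)
  then show ?case
    using step.IH by (simp add: progression_Suc insert_commute)
qed

text \<open>Adjoin elements in decreasing order, starting from two, which always form a progression.
  A new minimum either extends the progression downwards, or breaks it and yields the bound at once.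
  After a break, every new minimum adds at least \<open>h\<close> sums, which preserves the
  bound.\<close>

lemma progression_or_card_hfold_sumset_ge:
  fixes A :: "'a::linordered_ab_group_add set"
  assumes "2 \<le> h" "finite A" "2 \<le> card A"
  shows "(\<exists>a d. 0 < d \<and> A = progression a d (card A)) \<or> h * card A \<le> card (hfold_sumset h A)"
  using assms(2,3)
proof (induction rule: finite_linorder_min_induct)
  case (insert x A)
  then have card: "card (insert x A) = Suc (card A)" "1 \<le> card A" by auto
  consider (one) "card A = 1" | (ge2) "2 \<le> card A" using card by linarith
  then show ?case
  proof cases
    case one
    then obtain b where b: "A = {b}" by (auto simp: card_1_singleton_iff)
    then have "insert x A = progression x (b - x) (card (insert x A))" "0 < b - x"
      using insert.hyps one by (auto simp: card progression_Suc)
    then show ?thesis by blast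
  next
    case ge2
    from insert.IH[OF ge2] show ?thesis
    proof (elim disjE exE conjE)
      fix a d assume d: "0 < d" and A: "A = progression a d (card A)"
      define n where "n = card A"
      have n: "2 \<le> n" "card (insert x A) = Suc n"
        using ge2 card by (simp_all add: n_def)
      have A: "A = progression a d n"
        unfolding n_def by (fact A)
      have "a \<in> A"
        using n(1) unfolding A by (simp add: first_mem_progression)
      then have "x < a" using insert.hyps by blast
      show ?thesis
      proof (cases "x = a - d")
        case True
        then have "insert x A = progression x d (card (insert x A))"
          unfolding n(2) unfolding A by (simp add: progression_insert_first)
        then show ?thesis using d by blast
      next
        case False
        then have "h * card (insert x A) \<le> card (hfold_sumset h (insert x A))"
          unfolding n(2) unfolding A
          using d \<open>x < a\<close> assms(1) n(1) by (intro card_hfold_sumset_insert_progression)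
        then show ?thesis ..
      qed
    next
      assume "h * card A \<le> card (hfold_sumset h A)"
      moreover have "card (hfold_sumset h A) + h \<le> card (hfold_sumset h (insert x A))"
        using insert.hyps ge2 by (intro card_hfold_sumset_insert_min) auto
      ultimately show ?thesis using card by simp
    qed
  qed
qed simp

theorem theorem7:
  fixes h k :: nat
  assumes nontrivial: "\<exists>x::'a::linordered_ab_group_add. x \<noteq> 0"
    and "h \<ge> 3" and "k \<ge> 3"
  shows "(h * k - h + 1 \<in> sumset_sizes (UNIV :: 'a set) h k \<and>
          (\<forall>n \<in> sumset_sizes (UNIV :: 'a set) h k. h * k - h + 1 \<le> n)) \<and>
         h * k - h + 2 \<notin> sumset_sizes (UNIV :: 'a set) h k \<and>
         \<not> nat_interval (sumset_sizes (UNIV :: 'a set) h k)"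
proof -
  let ?S = "sumset_sizes (UNIV :: 'a set) h k"
  obtain n where k: "k = Suc n" and n: "2 \<le> n"
    using assms(3) by (cases k) auto
  have hk: "h * k - h = h * n" by (simp add: k)
  obtain x :: 'a where "x \<noteq> 0"
    using nontrivial by blast
  then have "0 < x \<or> 0 < - x" by auto
  then obtain g :: 'a where g: "0 < g" by blast
  have lower: "h * n + 1 \<le> m" if m: "m \<in> ?S" for m
  proof -
    obtain A :: "'a set" where A: "finite A" "card A = k" "m = card (hfold_sumset h A)"
      using m by (auto simp: sumset_sizes_def)
    then have "A \<noteq> {}" using assms(3) by auto
    from card_hfold_sumset_ge[OF A(1) this, of h] show ?thesis
      using A by (simp add: k)
  qed
  have mem: "h * n + 1 \<in> ?S"
  proof -
    have in_S: "card (hfold_sumset h (progression 0 g k)) \<in> ?S"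
      by (intro mem_sumset_sizesI finite_progression card_progression g subset_UNIV)
    \<comment> \<open>The general lower bound, applied to this progression itself, turns the upper
      estimate into an equality.\<close>
    have "card (hfold_sumset h (progression 0 g k)) = h * n + 1"
      by (rule antisym[OF _ lower[OF in_S]]) (simp only: k card_hfold_sumset_progression_le)
    with in_S show ?thesis by simp
  qed
  have gap: "h * n + 2 \<notin> ?S"
  proof
    assume "h * n + 2 \<in> ?S"
    then obtain A :: "'a set" where A: "finite A" "card A = k" "card (hfold_sumset h A) = h * n + 2"
      by (auto simp: sumset_sizes_def)
    \<comment> \<open>A progression has at most \<open>h * n + 1\<close> sums, and any other set has
      at least \<open>h * k = h * n + h\<close>. Since \<open>h \<ge> 3\<close>, the value
      \<open>h * n + 2\<close> falls strictly between.\<close>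
    have "(\<exists>a d. 0 < d \<and> A = progression a d k) \<or> h * k \<le> h * n + 2"
      using progression_or_card_hfold_sumset_ge[of h A] assms(2,3) unfolding A(2,3)
      by (simp add: A(1))
    then consider a d where "A = progression a d k" | "h * k \<le> h * n + 2"
      by blast
    then show False
    proof cases
      case 1
      then show False
        using card_hfold_sumset_progression_le[of h a d n] A by (simp add: k)
    next
      case 2
      then show False using assms(2) by (simp add: k)
    qed
  qed
  \<comment> \<open>To refute convexity, a size above the gap is needed too. The least elements
    \<open>-2g\<close>, \<open>0\<close>, \<open>g\<close> of \<open>B\<close> have gaps
    \<open>2g\<close> and \<open>g\<close>, so \<open>B\<close> has at least
    \<open>h * k > h * n + 2\<close> sums.\<close>
  define B where "B = insert (- (g + g)) (progression 0 g n)"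
  have neg: "- (g + g) < 0" and neg_ne: "- (g + g) \<noteq> 0 - g"
    using g by (simp_all add: add_pos_pos)
  have "- (g + g) \<notin> progression 0 g n"
  proof
    assume "- (g + g) \<in> progression 0 g n"
    then obtain i where "- (g + g) = nmult i g" by (auto simp: progression_def)
    then show False using nmult_le_mono[OF g, of 0 i] neg by simp
  qed
  then have "finite B" "card B = k"
    using card_progression[OF g] by (simp_all add: B_def k)
  then have B: "card (hfold_sumset h B) \<in> ?S"
    by (simp add: mem_sumset_sizesI)
  have "h * k \<le> card (hfold_sumset h B)"
    using card_hfold_sumset_insert_progression[OF g neg neg_ne _ n, of h] assms(2)
    by (simp only: B_def k)
  then have "h * n + 2 \<in> {h * n + 1..card (hfold_sumset h B)}"
    using assms(2) by (simp add: k)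
  then have "\<not> nat_interval ?S"
    using mem B gap unfolding nat_interval_def by blast
  then show ?thesis
    using lower mem gap by (simp add: hk)
qed

end
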